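(* Let $(M,g)$ be a compact connected Riemannian manifold, with or without boundary, let $x_0\in M$, and let $r(x)=d_g(x_0,x)$ be the Riemannian distance from $x_0$ to $x$. Let $f:(0,\infty)\to[0,\infty)$ be a non-negative strictly decreasing function. Let $C>0$ be a constant and let $\Omega^*$ be the geodesic ball centered at $x_0$ of radius $R$, where $R$ is such that $\operatorname{Vol}_g(\Omega^* )=C$. Then $$\sup_{\Omega\subset M,\ \operatorname{Vol}_g(\Omega)=C}\ \int_\Omega f(r(x))\,d\sigma(x)=\int_{\Omega^*} f(r(x))\,d\sigma(x),$$ where the supremum is over measurable subsets $\Omega$ of $M$ with volume $C$.
   Context: $\sigma$ is the Riemannian volume measure on $M$ and $\operatorname{Vol}_g(\Omega)=\sigma(\Omega)$. The geodesic ball of radius $R$ centered at $x_0$ is $\{x\in M: d_g(x_0,x)<R\}$. The integrals take values in $[0,\infty]$; $f(r(x))$ is defined for $x\ne x_0$, that is, almost everywhere. *)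

theory Defs
  imports "HOL-Analysis.Analysis"
begin

section \<open>Smooth maps on subsets of Euclidean space\<close>

text \<open>\<open>Ck_on k W f\<close> is meant for open \<open>W\<close> in a Euclidean space: \<open>f\<close> is \<open>k\<close> times
  continuously differentiable on \<open>W\<close>, expressed through iterated directional derivatives.\<close>

primrec Ck_on :: "nat \<Rightarrow> 'v::euclidean_space set \<Rightarrow> ('v \<Rightarrow> 'w::real_normed_vector) \<Rightarrow> bool" where
  "Ck_on 0 W f \<longleftrightarrow> continuous_on W f"
| "Ck_on (Suc k) W f \<longleftrightarrow>
     f differentiable_on W \<and> (\<forall>v. Ck_on k W (\<lambda>x. frechet_derivative f (at x) v))"

text \<open>On a set that need not be open (here: relatively open subsets of a half-space), smooth
  means locally extendable to a smooth map on an open set.\<close>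

definition smooth_on :: "'v::euclidean_space set \<Rightarrow> ('v \<Rightarrow> 'w::real_normed_vector) \<Rightarrow> bool" where
  "smooth_on S f \<longleftrightarrow>
     (\<forall>x\<in>S. \<exists>W F. open W \<and> x \<in> W \<and> (\<forall>y\<in>W \<inter> S. F y = f y) \<and> (\<forall>k. Ck_on k W F))"


section \<open>Smooth manifolds with or without boundary\<close>

text \<open>A chart is its domain together with its coordinate map; the values of the coordinate map
  outside the domain are irrelevant. The dimension is \<open>CARD('n) \<ge> 1\<close>.\<close>

type_synonym ('a, 'n) chart = "'a set \<times> ('a \<Rightarrow> real ^ 'n)"

definition half_space :: "'n::finite \<Rightarrow> (real ^ 'n) set" where
  "half_space k = {x. 0 \<le> x $ k}"

text \<open>Interior charts take values in an open subset of \<open>real ^ 'n\<close>. Since the index type has no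
  distinguished coordinate, boundary charts may use any of the coordinate half-spaces.\<close>

definition is_chart :: "'a topology \<Rightarrow> ('a, 'n::finite) chart \<Rightarrow> bool" where
  "is_chart T c \<longleftrightarrow>
     openin T (fst c) \<and>
     (\<exists>H. (H = UNIV \<or> (\<exists>k. H = half_space k)) \<and> openin (top_of_set H) (snd c ` fst c)) \<and>
     homeomorphic_map (subtopology T (fst c)) (top_of_set (snd c ` fst c)) (snd c)"

definition chart_inv :: "('a, 'n::finite) chart \<Rightarrow> real ^ 'n \<Rightarrow> 'a" where
  "chart_inv c = inv_into (fst c) (snd c)"

definition transition :: "('a, 'n::finite) chart \<Rightarrow> ('a, 'n) chart \<Rightarrow> real ^ 'n \<Rightarrow> real ^ 'n" where
  "transition c d = snd d \<circ> chart_inv c"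

text \<open>Atlases are not required to be maximal: all notions below are the same for an atlas and
  for the smooth structure it generates.\<close>

definition smooth_atlas :: "'a topology \<Rightarrow> ('a, 'n::finite) chart set \<Rightarrow> bool" where
  "smooth_atlas T A \<longleftrightarrow>
     (\<forall>c\<in>A. is_chart T c) \<and> (\<Union>c\<in>A. fst c) = topspace T \<and>
     (\<forall>c\<in>A. \<forall>d\<in>A. smooth_on (snd c ` (fst c \<inter> fst d)) (transition c d))"

definition smooth_manifold :: "'a topology \<Rightarrow> ('a, 'n::finite) chart set \<Rightarrow> bool" where
  "smooth_manifold T A \<longleftrightarrow> Hausdorff_space T \<and> second_countable T \<and> smooth_atlas T A"


section \<open>Riemannian metrics\<close>

text \<open>A metric is given by its Gram matrices \<open>g c p\<close>, where \<open>p\<close> lies in the domain of the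
  chart \<open>c\<close>. The last condition is the transformation law of a covariant 2-tensor; the image of
  an overlap is relatively open in a half-space, so that derivatives within it are unique.\<close>

type_synonym ('a, 'n) gram = "('a, 'n) chart \<Rightarrow> 'a \<Rightarrow> real ^ 'n ^ 'n"

definition riemannian_metric ::
    "('a, 'n::finite) chart set \<Rightarrow> ('a, 'n) gram \<Rightarrow> bool" where
  "riemannian_metric A g \<longleftrightarrow>
     (\<forall>c\<in>A. \<forall>p\<in>fst c. transpose (g c p) = g c p \<and> (\<forall>v. v \<noteq> 0 \<longrightarrow> 0 < v \<bullet> (g c p *v v))) \<and>
     (\<forall>c\<in>A. smooth_on (snd c ` fst c) (\<lambda>x. g c (chart_inv c x))) \<and>
     (\<forall>c\<in>A. \<forall>d\<in>A. \<forall>p\<in>fst c \<inter> fst d. \<forall>J.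
        (transition c d has_derivative J) (at (snd c p) within snd c ` (fst c \<inter> fst d)) \<longrightarrow>
        (\<forall>u v. u \<bullet> (g c p *v v) = J u \<bullet> (g d p *v J v)))"

definition riemannian_manifold ::
    "'a topology \<Rightarrow> ('a, 'n::finite) chart set \<Rightarrow> ('a, 'n) gram \<Rightarrow> bool" where
  "riemannian_manifold T A g \<longleftrightarrow> smooth_manifold T A \<and> riemannian_metric A g"


section \<open>Riemannian distance\<close>

definition C1_curve ::
    "'a topology \<Rightarrow> ('a, 'n::finite) chart set \<Rightarrow> real \<Rightarrow> real \<Rightarrow> (real \<Rightarrow> 'a) \<Rightarrow> bool" where
  "C1_curve T A a b \<gamma> \<longleftrightarrow>
     continuous_map (top_of_set {a..b}) T \<gamma> \<and>
     (\<forall>c\<in>A. \<exists>v. continuous_on {t\<in>{a..b}. \<gamma> t \<in> fst c} v \<and>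
        (\<forall>t\<in>{a..b}. \<gamma> t \<in> fst c \<longrightarrow>
           ((snd c \<circ> \<gamma>) has_vector_derivative v t) (at t within {a..b})))"

definition piecewise_C1_curve ::
    "'a topology \<Rightarrow> ('a, 'n::finite) chart set \<Rightarrow> (real \<Rightarrow> 'a) \<Rightarrow> bool" where
  "piecewise_C1_curve T A \<gamma> \<longleftrightarrow>
     (\<exists>(s :: nat \<Rightarrow> real) n. s 0 = 0 \<and> s n = 1 \<and>
        (\<forall>i<n. s i < s (Suc i) \<and> C1_curve T A (s i) (s (Suc i)) \<gamma>))"

text \<open>The norm of the velocity, computed in an arbitrarily chosen chart around \<open>\<gamma> t\<close>; by the
  transformation law the choice does not matter. At the finitely many break points the velocity
  may be undefined, which does not affect the length.\<close>

definition speed ::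
    "('a, 'n::finite) chart set \<Rightarrow> ('a, 'n) gram \<Rightarrow> (real \<Rightarrow> 'a) \<Rightarrow> real \<Rightarrow> real" where
  "speed A g \<gamma> t =
     (let c = (SOME c. c \<in> A \<and> \<gamma> t \<in> fst c);
          v = vector_derivative (snd c \<circ> \<gamma>) (at t within {0..1})
      in sqrt (v \<bullet> (g c (\<gamma> t) *v v)))"

definition curve_length ::
    "('a, 'n::finite) chart set \<Rightarrow> ('a, 'n) gram \<Rightarrow> (real \<Rightarrow> 'a) \<Rightarrow> real" where
  "curve_length A g \<gamma> = integral {0..1} (speed A g \<gamma>)"

text \<open>Used on connected manifolds only, where the infimum is over a nonempty set.\<close>

definition riemannian_dist ::
    "'a topology \<Rightarrow> ('a, 'n::finite) chart set \<Rightarrow> ('a, 'n) gram \<Rightarrow> 'a \<Rightarrow> 'a \<Rightarrow> real" where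
  "riemannian_dist T A g x y =
     Inf {curve_length A g \<gamma> |\<gamma>. piecewise_C1_curve T A \<gamma> \<and> \<gamma> 0 = x \<and> \<gamma> 1 = y}"

definition geodesic_ball ::
    "'a topology \<Rightarrow> ('a, 'n::finite) chart set \<Rightarrow> ('a, 'n) gram \<Rightarrow> 'a \<Rightarrow> real \<Rightarrow> 'a set" where
  "geodesic_ball T A g x R = {y \<in> topspace T. riemannian_dist T A g x y < R}"


section \<open>Riemannian volume measure\<close>

text \<open>The Riemannian volume measure is the unique measure on the sets that are Lebesgue measurable
  in charts which is \<open>sqrt (det g) dx\<close> in every chart. (A countable subatlas covers the
  manifold, so these conditions determine it.)\<close>

definition riemannian_volume ::
    "'a topology \<Rightarrow> ('a, 'n::finite) chart set \<Rightarrow> ('a, 'n) gram \<Rightarrow> 'a measure \<Rightarrow> bool" where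
  "riemannian_volume T A g \<sigma> \<longleftrightarrow>
     space \<sigma> = topspace T \<and>
     sets \<sigma> = {E. E \<subseteq> topspace T \<and> (\<forall>c\<in>A. snd c ` (E \<inter> fst c) \<in> sets lebesgue)} \<and>
     (\<forall>c\<in>A. \<forall>E\<in>sets \<sigma>. E \<subseteq> fst c \<longrightarrow>
        emeasure \<sigma> E =
          (\<integral>\<^sup>+x\<in>snd c ` E. ennreal (sqrt (det (g c (chart_inv c x)))) \<partial>lebesgue))"

end

theory Submission
  imports Defs
begin

text \<open>
  The theorem is an instance of the bathtub principle. Write \<open>r\<close> for the distance from the centre
  and \<open>B\<close> for the ball of radius \<open>R\<close>, and let \<open>\<Omega>\<close> have the same volume. Since \<open>f\<close> is decreasing,
  \<open>f \<circ> r \<ge> f R\<close> on \<open>B\<close> and \<open>f \<circ> r \<le> f R\<close> off \<open>B\<close>. The sets \<open>\<Omega> - B\<close> and \<open>B - \<Omega>\<close> have equal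
  volume, so replacing the first by the second does not decrease the integral, and this turns \<open>\<Omega>\<close>
  into \<open>B\<close> (lemma \<open>nn_integral_bathtub\<close>). As \<open>B\<close> itself competes, the supremum is attained at it.

  Measurability of \<open>f \<circ> r\<close> is avoided altogether: the integral of an arbitrary nonnegative function is
  the supremum over the simple functions below it, and this lower integral is additive over disjoint
  measurable sets (lemma \<open>nn_integral_Un_disjoint_lower\<close>). The ball is measurable because its
  measure is nonzero.

  What remains is geometry. The function \<open>f\<close> is controlled on positive arguments only, so one
  needs \<open>r > 0\<close> away from the centre, and \<open>R > 0\<close>. Positivity (lemma \<open>riemannian_dist_pos\<close>) holds
  because, by compactness, the metric dominates a multiple of the Euclidean one on a small closed ball
  in a chart around the centre, and a curve to another point has to leave such a ball, which costs a
  fixed length (lemma \<open>curve_length_ge_if_leaves_ball\<close>). To make sense of this, the speed of a curve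
  must not depend on the chart in which it is computed and must be integrable. Finally, an infimum over
  the empty set of curves would be an arbitrary number, so connectedness is used to join any two points
  by chart segments (lemma \<open>connected_imp_joined\<close>). The centre, where nothing is known about \<open>f\<close>, is
  a null set.
\<close>

section \<open>Rearranging a lower integral\<close>

text \<open>Restricting a simple function below \<open>h\<close> to \<open>X\<close> and to \<open>Y\<close> keeps it below \<open>h\<close>, and conversely two
  simple functions supported on the disjoint sets add up to one below \<open>h\<close>. For a nonmeasurable \<open>h\<close> the
  integral is only a lower integral, which is not additive in the integrand, but it still is
  additive in the measurable domain.\<close>

lemma nn_integral_Un_disjoint_lower:
  fixes h :: "'a \<Rightarrow> ennreal"
  assumes X: "X \<in> sets M" and Y: "Y \<in> sets M" and XY: "X \<inter> Y = {}"
  shows "(\<integral>\<^sup>+x\<in>X \<union> Y. h x \<partial>M) = (\<integral>\<^sup>+x\<in>X. h x \<partial>M) + (\<integral>\<^sup>+x\<in>Y. h x \<partial>M)"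
proof (rule antisym)
  let ?S = "\<lambda>u. {s. simple_function M s \<and> s \<le> u}"
  show "(\<integral>\<^sup>+x\<in>X \<union> Y. h x \<partial>M) \<le> (\<integral>\<^sup>+x\<in>X. h x \<partial>M) + (\<integral>\<^sup>+x\<in>Y. h x \<partial>M)"
    unfolding nn_integral_def[of M "\<lambda>x. h x * indicator (X \<union> Y) x"]
  proof (rule SUP_least, clarify)
    fix s assume s: "simple_function M s" "s \<le> (\<lambda>x. h x * indicator (X \<union> Y) x)"
    have le: "s x \<le> h x * indicator (X \<union> Y) x" for x
      using s(2) by (auto simp: le_fun_def)
    have eq: "s x = s x * indicator X x + s x * indicator Y x" for x
      using le[of x] XY by (auto simp: indicator_def split: if_splits)
    have "integral\<^sup>S M s = (\<integral>\<^sup>+x. s x \<partial>M)"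
      using s(1) by (simp add: nn_integral_eq_simple_integral)
    also have "\<dots> = (\<integral>\<^sup>+x. s x * indicator X x + s x * indicator Y x \<partial>M)"
      using eq by simp
    also have "\<dots> = (\<integral>\<^sup>+x. s x * indicator X x \<partial>M) + (\<integral>\<^sup>+x. s x * indicator Y x \<partial>M)"
      using borel_measurable_simple_function[OF s(1)] X Y by (intro nn_integral_add) auto
    also have "\<dots> \<le> (\<integral>\<^sup>+x\<in>X. h x \<partial>M) + (\<integral>\<^sup>+x\<in>Y. h x \<partial>M)"
    proof (intro add_mono nn_integral_mono)
      show "s x * indicator X x \<le> h x * indicator X x" for x
        using le[of x] by (auto simp: indicator_def split: if_splits)
      show "s x * indicator Y x \<le> h x * indicator Y x" for x
        using le[of x] by (auto simp: indicator_def split: if_splits)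
    qed
    finally show "integral\<^sup>S M s \<le> (\<integral>\<^sup>+x\<in>X. h x \<partial>M) + (\<integral>\<^sup>+x\<in>Y. h x \<partial>M)" .
  qed
  have ne: "?S u \<noteq> {}" for u :: "'a \<Rightarrow> ennreal"
    by (auto simp: le_fun_def intro!: exI[of _ "\<lambda>_. 0"])
  show "(\<integral>\<^sup>+x\<in>X. h x \<partial>M) + (\<integral>\<^sup>+x\<in>Y. h x \<partial>M) \<le> (\<integral>\<^sup>+x\<in>X \<union> Y. h x \<partial>M)"
    unfolding nn_integral_def[of M "\<lambda>x. h x * indicator X x"]
      nn_integral_def[of M "\<lambda>x. h x * indicator Y x"]
      ennreal_SUP_add_left[OF ne, symmetric]
  proof (rule SUP_least, clarify)
    fix s assume s: "simple_function M s" "s \<le> (\<lambda>x. h x * indicator X x)"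
    show "integral\<^sup>S M s + (SUP t\<in>?S (\<lambda>x. h x * indicator Y x). integral\<^sup>S M t)
        \<le> (\<integral>\<^sup>+x\<in>X \<union> Y. h x \<partial>M)"
      unfolding ennreal_SUP_add_right[OF ne]
    proof (rule SUP_least, clarify)
      fix t assume t: "simple_function M t" "t \<le> (\<lambda>x. h x * indicator Y x)"
      have "integral\<^sup>S M s + integral\<^sup>S M t = (\<integral>\<^sup>+x. s x \<partial>M) + (\<integral>\<^sup>+x. t x \<partial>M)"
        using s(1) t(1) by (simp add: nn_integral_eq_simple_integral)
      also have "\<dots> = (\<integral>\<^sup>+x. s x + t x \<partial>M)"
        using borel_measurable_simple_function[OF s(1)] borel_measurable_simple_function[OF t(1)]
        by (intro nn_integral_add[symmetric]) auto
      also have "\<dots> \<le> (\<integral>\<^sup>+x\<in>X \<union> Y. h x \<partial>M)"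
      proof (rule nn_integral_mono)
        fix x
        have "s x \<le> h x * indicator X x" "t x \<le> h x * indicator Y x"
          using s(2) t(2) by (auto simp: le_fun_def)
        then show "s x + t x \<le> h x * indicator (X \<union> Y) x"
          using XY by (cases "x \<in> X"; cases "x \<in> Y") (auto simp: indicator_def)
      qed
      finally show "integral\<^sup>S M s + integral\<^sup>S M t \<le> (\<integral>\<^sup>+x\<in>X \<union> Y. h x \<partial>M)" .
    qed
  qed
qed

text \<open>The exchange of \<open>\<Omega> - B\<close> for \<open>B - \<Omega>\<close>, with the threshold \<open>k\<close> separating the values of \<open>h\<close> inside
  and outside \<open>B\<close>. The exceptional set \<open>N\<close> absorbs points at which \<open>h\<close> is unknown.\<close>

lemma nn_integral_bathtub:
  fixes h :: "'a \<Rightarrow> ennreal" and k :: ennreal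
  assumes B: "B \<in> sets M" and \<Omega>: "\<Omega> \<in> sets M"
    and same: "emeasure M \<Omega> = emeasure M B" and fin: "emeasure M B < \<infinity>"
    and N: "N \<in> null_sets M"
    and inside: "\<And>x. x \<in> B - N \<Longrightarrow> k \<le> h x"
    and outside: "\<And>x. x \<in> space M - B \<Longrightarrow> h x \<le> k"
  shows "(\<integral>\<^sup>+x\<in>\<Omega>. h x \<partial>M) \<le> (\<integral>\<^sup>+x\<in>B. h x \<partial>M)"
proof -
  have Ns: "N \<in> sets M" using N by auto
  have "emeasure M (\<Omega> \<inter> B) \<le> emeasure M B"
    using B by (intro emeasure_mono) auto
  then have "emeasure M (\<Omega> \<inter> B) \<noteq> \<infinity>"
    using fin by auto
  \<comment> \<open>finiteness is what allows cancelling the common part of the two sets\<close>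
  then have "emeasure M (\<Omega> - \<Omega> \<inter> B) = emeasure M (B - \<Omega> \<inter> B)"
    using B \<Omega> same by (simp add: emeasure_Diff)
  then have diff: "emeasure M (\<Omega> - B) = emeasure M (B - \<Omega>)"
    by (simp add: Diff_Int Int_commute)
  have "(\<integral>\<^sup>+x\<in>\<Omega>. h x \<partial>M) = (\<integral>\<^sup>+x\<in>(\<Omega> \<inter> B) \<union> (\<Omega> - B). h x \<partial>M)"
    by (simp add: Int_Diff_Un)
  also have "\<dots> = (\<integral>\<^sup>+x\<in>\<Omega> \<inter> B. h x \<partial>M) + (\<integral>\<^sup>+x\<in>\<Omega> - B. h x \<partial>M)"
    using B \<Omega> by (intro nn_integral_Un_disjoint_lower) auto
  also have "(\<integral>\<^sup>+x\<in>\<Omega> - B. h x \<partial>M) \<le> (\<integral>\<^sup>+x. k * indicator (\<Omega> - B) x \<partial>M)"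
    using outside by (intro nn_integral_mono) (auto simp: indicator_def)
  also have "\<dots> = k * emeasure M (B - \<Omega>)"
    using B \<Omega> diff by (simp add: nn_integral_cmult_indicator)
  also have "\<dots> = k * emeasure M (B - \<Omega> - N)"
    using B \<Omega> N by (simp add: emeasure_Diff_null_set)
  also have "\<dots> = (\<integral>\<^sup>+x. k * indicator (B - \<Omega> - N) x \<partial>M)"
    using B \<Omega> Ns by (simp add: nn_integral_cmult_indicator)
  also have "\<dots> \<le> (\<integral>\<^sup>+x\<in>B - \<Omega>. h x \<partial>M)"
    using inside by (intro nn_integral_mono) (auto simp: indicator_def)
  also have "(\<integral>\<^sup>+x\<in>\<Omega> \<inter> B. h x \<partial>M) + (\<integral>\<^sup>+x\<in>B - \<Omega>. h x \<partial>M)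
      = (\<integral>\<^sup>+x\<in>(\<Omega> \<inter> B) \<union> (B - \<Omega>). h x \<partial>M)"
    using B \<Omega> by (intro nn_integral_Un_disjoint_lower[symmetric]) auto
  also have "(\<Omega> \<inter> B) \<union> (B - \<Omega>) = B" by auto
  finally show ?thesis by (simp add: add_left_mono)
qed

section \<open>Charts\<close>

locale riemannian =
  fixes T :: "'a topology"
    and A :: "('a, 'n::finite) chart set"
    and g :: "('a, 'n) gram"
  assumes riemannian_manifold: "riemannian_manifold T A g"
begin

lemma Hausdorff: "Hausdorff_space T"
  and charts: "c \<in> A \<Longrightarrow> is_chart T c"
  and charts_cover: "(\<Union>c\<in>A. fst c) = topspace T"
  and transition_smooth:
    "c \<in> A \<Longrightarrow> d \<in> A \<Longrightarrow> smooth_on (snd c ` (fst c \<inter> fst d)) (transition c d)"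
  and metric: "riemannian_metric A g"
  using riemannian_manifold
  unfolding riemannian_manifold_def smooth_manifold_def smooth_atlas_def by auto

lemma chart_around: "p \<in> topspace T \<Longrightarrow> \<exists>c\<in>A. p \<in> fst c"
  using charts_cover by auto

lemma chart_domain_openin: "c \<in> A \<Longrightarrow> openin T (fst c)"
  using charts unfolding is_chart_def by auto

lemma chart_domain_subset: "c \<in> A \<Longrightarrow> fst c \<subseteq> topspace T"
  using chart_domain_openin openin_subset by blast

lemma chart_topspace: "c \<in> A \<Longrightarrow> topspace (subtopology T (fst c)) = fst c"
  using chart_domain_subset[of c] by (simp add: Int_absorb1)

lemma chart_inj_on: "c \<in> A \<Longrightarrow> inj_on (snd c) (fst c)"
  using charts[of c] chart_topspace[of c] unfolding is_chart_def homeomorphic_map_def by simp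

lemma chart_inv_chart [simp]: "c \<in> A \<Longrightarrow> q \<in> fst c \<Longrightarrow> chart_inv c (snd c q) = q"
  unfolding chart_inv_def using chart_inj_on by (simp add: inv_into_f_f)

lemma continuous_map_chart: "c \<in> A \<Longrightarrow> continuous_map (subtopology T (fst c)) euclidean (snd c)"
  using charts[of c] homeomorphic_imp_continuous_map
  unfolding is_chart_def by (metis continuous_map_into_fulltopology)

lemma continuous_map_chart_inv:
  assumes c: "c \<in> A"
  shows "continuous_map (top_of_set (snd c ` fst c)) T (chart_inv c)"
proof -
  obtain \<psi> where "homeomorphic_maps (subtopology T (fst c)) (top_of_set (snd c ` fst c)) (snd c) \<psi>"
    using charts[OF c] unfolding is_chart_def homeomorphic_map_maps by auto
  then have \<psi>: "continuous_map (top_of_set (snd c ` fst c)) (subtopology T (fst c)) \<psi>"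
    and inv: "\<And>q. q \<in> fst c \<Longrightarrow> \<psi> (snd c q) = q"
    using chart_topspace[OF c] unfolding homeomorphic_maps_def by auto
  have "continuous_map (top_of_set (snd c ` fst c)) (subtopology T (fst c)) (chart_inv c)"
    by (rule continuous_map_eq[OF \<psi>]) (use c inv in auto)
  then show ?thesis
    using continuous_map_into_fulltopology by blast
qed

lemma openin_chart_vimage:
  assumes c: "c \<in> A" and W: "open W"
  shows "openin T {q \<in> fst c. snd c q \<in> W}"
proof -
  have "openin (subtopology T (fst c)) {q \<in> topspace (subtopology T (fst c)). snd c q \<in> W}"
    using continuous_map_chart[OF c] W by (intro openin_continuous_map_preimage) auto
  then show ?thesis
    unfolding chart_topspace[OF c] using openin_trans_full chart_domain_openin[OF c] by blast
qed

text \<open>Near the point the image of the chart agrees with a closed convex set, namely the whole space or a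
  half-space; intersecting with a ball keeps convexity and adds compactness. This treats interior and
  boundary points alike: compactness serves the lower bound on lengths, convexity the
  joining of nearby points by segments.\<close>

lemma chart_small_ball:
  assumes c: "c \<in> A" and p: "p \<in> fst c" and e: "0 < e"
  obtains \<epsilon> where "0 < \<epsilon>" "\<epsilon> < e" "compact (cball (snd c p) \<epsilon> \<inter> snd c ` fst c)"
    "convex (cball (snd c p) \<epsilon> \<inter> snd c ` fst c)"
proof -
  obtain H where H: "H = UNIV \<or> (\<exists>k. H = half_space k)"
    and V: "openin (top_of_set H) (snd c ` fst c)"
    using charts[OF c] unfolding is_chart_def by auto
  have closed: "closed H"
    using H by (auto simp: half_space_def intro!: closed_Collect_le continuous_intros)
  have convex: "convex H"
  proof -
    have "half_space k = {x. 0 \<le> inner (axis k 1) x}" for k :: 'n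
      by (auto simp: half_space_def inner_axis' )
    then show ?thesis using H convex_halfspace_ge by auto
  qed
  have sub: "snd c ` fst c \<subseteq> H" using V openin_imp_subset by blast
  obtain e1 where e1: "0 < e1" "ball (snd c p) e1 \<inter> H \<subseteq> snd c ` fst c"
    using V p unfolding openin_contains_ball by blast
  define \<epsilon> where "\<epsilon> = min e e1 / 2"
  have \<epsilon>: "0 < \<epsilon>" "\<epsilon> < e" "\<epsilon> < e1" using e e1 by (auto simp: \<epsilon>_def)
  have "cball (snd c p) \<epsilon> \<subseteq> ball (snd c p) e1" using \<epsilon> by auto
  then have eq: "cball (snd c p) \<epsilon> \<inter> snd c ` fst c = cball (snd c p) \<epsilon> \<inter> H"
    using sub e1 by blast
  show thesis
    using that[OF \<epsilon>(1,2)] closed convex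
    by (simp add: eq convex_Int compact_Int_closed)
qed

text \<open>At boundary points the smoothness of a transition map is that of a local extension \<open>F\<close> to an open
  set. For the calculus of curves it suffices that \<open>F\<close> is continuously differentiable.\<close>

lemma transition_extension:
  assumes c: "c \<in> A" and d: "d \<in> A" and p: "p \<in> fst c \<inter> fst d"
  obtains W F where "open W" "snd c p \<in> W" "F differentiable_on W"
    "\<And>v. continuous_on W (\<lambda>x. frechet_derivative F (at x) v)"
    "\<And>q. q \<in> fst c \<inter> fst d \<Longrightarrow> snd c q \<in> W \<Longrightarrow> F (snd c q) = snd d q"
    "\<And>x. x \<in> W \<inter> snd c ` (fst c \<inter> fst d) \<Longrightarrow> F x = transition c d x"
proof -
  have "snd c p \<in> snd c ` (fst c \<inter> fst d)" using p by blast
  then obtain W F where W: "open W" "snd c p \<in> W"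
    and F: "\<forall>x\<in>W \<inter> snd c ` (fst c \<inter> fst d). F x = transition c d x" and Ck: "\<forall>k. Ck_on k W F"
    using transition_smooth[OF c d] unfolding smooth_on_def by blast
  have "Ck_on (Suc 0) W F" using Ck by blast
  then have "F differentiable_on W" "\<And>v. continuous_on W (\<lambda>x. frechet_derivative F (at x) v)"
    by auto
  moreover have "F (snd c q) = snd d q" if "q \<in> fst c \<inter> fst d" "snd c q \<in> W" for q
    using F that c by (auto simp: transition_def)
  ultimately show thesis using that W F by blast
qed

lemma gram_continuous_on:
  assumes c: "c \<in> A"
  shows "continuous_on (snd c ` fst c) (\<lambda>x. g c (chart_inv c x))"
proof -
  have sm: "smooth_on (snd c ` fst c) (\<lambda>x. g c (chart_inv c x))"
    using metric c unfolding riemannian_metric_def by blast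
  show ?thesis
    unfolding continuous_on_eq_continuous_within
  proof
    fix x assume x: "x \<in> snd c ` fst c"
    obtain W F where W: "open W" "x \<in> W"
      and F: "\<forall>y\<in>W \<inter> snd c ` fst c. F y = g c (chart_inv c y)" and Ck: "\<forall>k. Ck_on k W F"
      using sm x unfolding smooth_on_def by blast
    have "Ck_on 0 W F" using Ck by blast
    then have "continuous (at x) F"
      using W by (simp add: continuous_on_eq_continuous_at)
    then have cont: "continuous (at x within snd c ` fst c) F"
      using continuous_at_imp_continuous_at_within by blast
    obtain e where "0 < e" "ball x e \<subseteq> W"
      using W open_contains_ball by blast
    then show "continuous (at x within snd c ` fst c) (\<lambda>x. g c (chart_inv c x))"
      using x F
      by (intro continuous_transform_within[OF cont, of e]) (auto simp: dist_commute subset_iff)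
  qed
qed

lemma gram_pos: "c \<in> A \<Longrightarrow> p \<in> fst c \<Longrightarrow> v \<noteq> 0 \<Longrightarrow> 0 < v \<bullet> (g c p *v v)"
  using metric unfolding riemannian_metric_def by blast

lemma gram_nonneg: "c \<in> A \<Longrightarrow> p \<in> fst c \<Longrightarrow> 0 \<le> v \<bullet> (g c p *v v)"
  using gram_pos[of c p v] by (cases "v = 0") auto

text \<open>The quadratic form of the metric is continuous and positive on the product of \<open>K\<close> with the unit
  sphere, hence has a positive minimum there; homogeneity extends the bound to all vectors.\<close>

lemma gram_lower_bound:
  assumes c: "c \<in> A" and K: "compact K" "K \<subseteq> snd c ` fst c"
  obtains m where "0 < m"
    "\<And>q v. q \<in> fst c \<Longrightarrow> snd c q \<in> K \<Longrightarrow> m * norm v \<le> sqrt (v \<bullet> (g c q *v v))"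
proof (cases "K = {}")
  case True
  then show thesis using that[of 1] by auto
next
  case False
  let ?Q = "\<lambda>z. snd z \<bullet> (g c (chart_inv c (fst z)) *v snd z)"
  let ?S = "K \<times> sphere (0 :: real ^ 'n) 1"
  have "continuous_on ?S (\<lambda>z. g c (chart_inv c (fst z)))"
    by (rule continuous_on_compose2[OF gram_continuous_on[OF c], where f = fst])
      (use K in \<open>auto intro: continuous_intros\<close>)
  then have "continuous_on ?S ?Q"
    unfolding matrix_vector_mult_def by (intro continuous_intros) auto
  moreover have "compact ?S" using K by (intro compact_Times) auto
  moreover have "?S \<noteq> {}" using False by simp
  ultimately obtain z where z: "z \<in> ?S" "\<And>w. w \<in> ?S \<Longrightarrow> ?Q z \<le> ?Q w"
    using continuous_attains_inf[of ?S ?Q] by meson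
  have "snd z \<noteq> 0" "chart_inv c (fst z) \<in> fst c"
    using z(1) K c by (auto simp: subset_iff image_iff)
  then have pos: "0 < ?Q z" using gram_pos c by blast
  show thesis
  proof (rule that[of "sqrt (?Q z)"])
    show "0 < sqrt (?Q z)" using pos by simp
    fix q and v :: "real ^ 'n" assume q: "q \<in> fst c" "snd c q \<in> K"
    show "sqrt (?Q z) * norm v \<le> sqrt (v \<bullet> (g c q *v v))"
    proof (cases "v = 0")
      case False
      define u where "u = v /\<^sub>R norm v"
      have v: "v = norm v *\<^sub>R u" using False by (simp add: u_def)
      have "(snd c q, u) \<in> ?S" using q False by (simp add: u_def)
      from z(2)[OF this] have "?Q z \<le> u \<bullet> (g c q *v u)" using q c by simp
      then have "sqrt (?Q z) * norm v \<le> sqrt (u \<bullet> (g c q *v u)) * norm v"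
        by (simp add: mult_right_mono)
      also have "\<dots> = sqrt ((u \<bullet> (g c q *v u)) * (norm v)\<^sup>2)"
        by (simp add: real_sqrt_mult)
      also have "(u \<bullet> (g c q *v u)) * (norm v)\<^sup>2 = v \<bullet> (g c q *v v)"
        by (subst (2 3) v) (simp add: matrix_vector_mult_scaleR power2_eq_square)
      finally show ?thesis .
    qed auto
  qed
qed

end

section \<open>Speed and length of curves\<close>

lemma partition_mono:
  fixes s :: "nat \<Rightarrow> real"
  assumes "\<forall>i<n. s i < s (Suc i)" "i \<le> j" "j \<le> n"
  shows "s i \<le> s j"
  using assms(2,3)
proof (induction rule: dec_induct)
  case (step k)
  then show ?case using assms(1) by (meson Suc_le_eq less_imp_le order_trans)
qed simp

lemma partition_covers:
  fixes s :: "nat \<Rightarrow> real"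
  assumes "t \<in> {s 0..s n}" "0 < n"
  shows "\<exists>i<n. t \<in> {s i..s (Suc i)}"
  using assms
proof (induction n)
  case (Suc n)
  show ?case
  proof (cases "0 < n \<and> t \<le> s n")
    case True
    then have "t \<in> {s 0..s n}" "0 < n" using Suc.prems by auto
    then obtain i where "i < n" "t \<in> {s i..s (Suc i)}" using Suc.IH by blast
    then show ?thesis using less_SucI by blast
  next
    case False
    then have "t \<in> {s n..s (Suc n)}" using Suc.prems by (cases "n = 0") auto
    then show ?thesis by (intro exI[of _ n]) simp
  qed
qed auto

context riemannian
begin

lemma curve_stays_in_open:
  fixes \<gamma> :: "real \<Rightarrow> 'a"
  assumes \<gamma>: "continuous_map (top_of_set S) T \<gamma>" and U: "openin T U"
    and t: "t \<in> S" "\<gamma> t \<in> U"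
  shows "\<exists>\<delta>>0. \<forall>s\<in>S. dist s t < \<delta> \<longrightarrow> \<gamma> s \<in> U"
proof -
  have "openin (top_of_set S) {s \<in> S. \<gamma> s \<in> U}"
    using openin_continuous_map_preimage[OF \<gamma> U] by simp
  then obtain \<delta> where "0 < \<delta>" "ball t \<delta> \<inter> S \<subseteq> {s \<in> S. \<gamma> s \<in> U}"
    using t unfolding openin_contains_ball by blast
  then show ?thesis
    by (intro exI[of _ \<delta>]) (auto simp: dist_commute subset_iff)
qed

text \<open>The chain rule for \<open>F \<circ> (snd c \<circ> \<gamma>)\<close>, which coincides with \<open>snd d \<circ> \<gamma>\<close> near \<open>t\<close> because \<open>\<gamma>\<close> stays
  in the overlap of the charts for a short time. The explicit derivative is needed later to see that the
  velocity depends continuously on \<open>t\<close>.\<close>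

lemma extension_velocity:
  fixes \<gamma> :: "real \<Rightarrow> 'a"
  assumes c: "c \<in> A" and d: "d \<in> A" and t: "t \<in> S" "\<gamma> t \<in> fst c \<inter> fst d"
    and \<gamma>: "continuous_map (top_of_set S) T \<gamma>"
    and u: "((snd c \<circ> \<gamma>) has_vector_derivative u) (at t within S)"
    and W: "open W" "snd c (\<gamma> t) \<in> W" and F: "F differentiable_on W"
    and Fd: "\<And>q. q \<in> fst c \<inter> fst d \<Longrightarrow> snd c q \<in> W \<Longrightarrow> F (snd c q) = snd d q"
  shows "((snd d \<circ> \<gamma>) has_vector_derivative frechet_derivative F (at (snd c (\<gamma> t))) u)
    (at t within S)"
proof -
  define J where "J = frechet_derivative F (at (snd c (\<gamma> t)))"
  have J: "(F has_derivative J) (at (snd c (\<gamma> t)))"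
    using F W unfolding J_def differentiable_on_def
    by (metis at_within_open frechet_derivative_works)
  let ?U = "{q \<in> fst c. snd c q \<in> W} \<inter> fst d"
  have "openin T ?U"
    using openin_chart_vimage[OF c W(1)] chart_domain_openin[OF d] by blast
  moreover have "\<gamma> t \<in> ?U" using t W by auto
  ultimately obtain \<delta> where \<delta>: "0 < \<delta>" "\<forall>s\<in>S. dist s t < \<delta> \<longrightarrow> \<gamma> s \<in> ?U"
    using curve_stays_in_open[OF \<gamma> _ t(1), of ?U] by meson
  have "(F \<circ> (snd c \<circ> \<gamma>) has_derivative J \<circ> (\<lambda>h. h *\<^sub>R u)) (at t within S)"
    using u J unfolding has_vector_derivative_def
    by (intro diff_chain_within) (auto intro: has_derivative_at_withinI)
  moreover have "J \<circ> (\<lambda>h. h *\<^sub>R u) = (\<lambda>h. h *\<^sub>R J u)"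
    using has_derivative_bounded_linear[OF J] by (auto simp: linear_simps)
  ultimately have "(F \<circ> (snd c \<circ> \<gamma>) has_vector_derivative J u) (at t within S)"
    unfolding has_vector_derivative_def by simp
  then have "((snd d \<circ> \<gamma>) has_vector_derivative J u) (at t within S)"
    by (rule has_vector_derivative_transform_within[OF _ \<delta>(1) t(1)]) (use \<delta>(2) Fd in auto)
  then show ?thesis unfolding J_def .
qed

text \<open>A common \<open>J\<close> for both conclusions links the velocities in two charts to the transformation law of
  the metric, which is phrased with derivatives of the transition map within the overlap.\<close>

lemma transition_velocity:
  fixes \<gamma> :: "real \<Rightarrow> 'a"
  assumes c: "c \<in> A" and d: "d \<in> A" and t: "t \<in> S" "\<gamma> t \<in> fst c \<inter> fst d"
    and \<gamma>: "continuous_map (top_of_set S) T \<gamma>"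
    and u: "((snd c \<circ> \<gamma>) has_vector_derivative u) (at t within S)"
  obtains J where
    "(transition c d has_derivative J) (at (snd c (\<gamma> t)) within snd c ` (fst c \<inter> fst d))"
    "((snd d \<circ> \<gamma>) has_vector_derivative J u) (at t within S)"
proof -
  let ?x = "snd c (\<gamma> t)"
  obtain W F where W: "open W" "?x \<in> W" and F: "F differentiable_on W"
    and Fd: "\<And>q. q \<in> fst c \<inter> fst d \<Longrightarrow> snd c q \<in> W \<Longrightarrow> F (snd c q) = snd d q"
    and Ft: "\<And>x. x \<in> W \<inter> snd c ` (fst c \<inter> fst d) \<Longrightarrow> F x = transition c d x"
    using transition_extension[OF c d t(2)] by metis
  define J where "J = frechet_derivative F (at ?x)"
  have J: "(F has_derivative J) (at ?x)"
    using F W unfolding J_def differentiable_on_def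
    by (metis at_within_open frechet_derivative_works)
  obtain e where e: "0 < e" "ball ?x e \<subseteq> W" using W open_contains_ball by blast
  have *: "(transition c d has_derivative J) (at ?x within snd c ` (fst c \<inter> fst d))"
  proof (rule has_derivative_transform_within[OF has_derivative_at_withinI[OF J] e(1)])
    show "?x \<in> snd c ` (fst c \<inter> fst d)" using t by blast
    show "F x' = transition c d x'" if "x' \<in> snd c ` (fst c \<inter> fst d)" "dist x' ?x < e" for x'
      using that e Ft[of x'] by (auto simp: dist_commute subset_iff)
  qed
  show thesis
    using that[OF *] extension_velocity[OF c d t \<gamma> u W F Fd] unfolding J_def by blast
qed

lemma speed_chart_independent:
  fixes \<gamma> :: "real \<Rightarrow> 'a"
  assumes c: "c \<in> A" and d: "d \<in> A" and ab: "a < b" and t: "t \<in> {a..b}" "\<gamma> t \<in> fst c \<inter> fst d"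
    and \<gamma>: "continuous_map (top_of_set {a..b}) T \<gamma>"
    and u: "((snd c \<circ> \<gamma>) has_vector_derivative u) (at t within {a..b})"
    and w: "((snd d \<circ> \<gamma>) has_vector_derivative w) (at t within {a..b})"
  shows "u \<bullet> (g c (\<gamma> t) *v u) = w \<bullet> (g d (\<gamma> t) *v w)"
proof -
  obtain J where
    J: "(transition c d has_derivative J) (at (snd c (\<gamma> t)) within snd c ` (fst c \<inter> fst d))"
    and Ju: "((snd d \<circ> \<gamma>) has_vector_derivative J u) (at t within {a..b})"
    using transition_velocity[OF c d t \<gamma> u] by metis
  have "w = J u"
    using vector_derivative_within_closed_interval[OF ab t(1)] w Ju by metis
  moreover have "u \<bullet> (g c (\<gamma> t) *v u) = J u \<bullet> (g d (\<gamma> t) *v J u)"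
    using metric c d t(2) J unfolding riemannian_metric_def by blast
  ultimately show ?thesis by simp
qed

text \<open>The speed with velocities taken relative to the interval of one piece of a curve. Unlike \<open>speed\<close>,
  whose velocities are relative to the unit interval, it is meaningful at break points.\<close>

definition piece_speed :: "real \<Rightarrow> real \<Rightarrow> (real \<Rightarrow> 'a) \<Rightarrow> real \<Rightarrow> real" where
  "piece_speed a b \<gamma> t =
     (let c = (SOME c. c \<in> A \<and> \<gamma> t \<in> fst c);
          v = vector_derivative (snd c \<circ> \<gamma>) (at t within {a..b})
      in sqrt (v \<bullet> (g c (\<gamma> t) *v v)))"

lemma piece_speed_in_chart:
  assumes \<gamma>: "C1_curve T A a b \<gamma>" and ab: "a < b" and t: "t \<in> {a..b}"
    and d: "d \<in> A" "\<gamma> t \<in> fst d"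
    and w: "((snd d \<circ> \<gamma>) has_vector_derivative w) (at t within {a..b})"
  shows "piece_speed a b \<gamma> t = sqrt (w \<bullet> (g d (\<gamma> t) *v w))"
proof -
  define c where "c = (SOME c. c \<in> A \<and> \<gamma> t \<in> fst c)"
  have c: "c \<in> A \<and> \<gamma> t \<in> fst c"
    unfolding c_def using d by (metis (mono_tags, lifting) someI)
  obtain u where u: "((snd c \<circ> \<gamma>) has_vector_derivative u) (at t within {a..b})"
    using \<gamma> c t unfolding C1_curve_def by blast
  have "continuous_map (top_of_set {a..b}) T \<gamma>" using \<gamma> unfolding C1_curve_def by blast
  then have "u \<bullet> (g c (\<gamma> t) *v u) = w \<bullet> (g d (\<gamma> t) *v w)"
    using speed_chart_independent[OF _ d(1) ab t _ _ u w] c d by blast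
  then show ?thesis
    using vector_derivative_within_closed_interval[OF ab t u]
    unfolding piece_speed_def c_def[symmetric] by simp
qed

text \<open>The arbitrarily chosen chart in the definition may jump with \<open>t\<close>, but near a given time the speed can
  be computed in one fixed chart, where it is visibly continuous.\<close>

lemma piece_speed_continuous:
  assumes \<gamma>: "C1_curve T A a b \<gamma>" and ab: "a < b"
  shows "continuous_on {a..b} (piece_speed a b \<gamma>)"
  unfolding continuous_on_eq_continuous_within
proof
  fix t assume t: "t \<in> {a..b}"
  have cont: "continuous_map (top_of_set {a..b}) T \<gamma>" using \<gamma> unfolding C1_curve_def by blast
  then have "\<gamma> t \<in> topspace T" using t by (auto simp: continuous_map_def)
  then obtain d where d: "d \<in> A" "\<gamma> t \<in> fst d" using chart_around by blast
  let ?I = "{s \<in> {a..b}. \<gamma> s \<in> fst d}"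
  obtain v where v: "continuous_on ?I v"
    and v': "\<And>s. s \<in> ?I \<Longrightarrow> ((snd d \<circ> \<gamma>) has_vector_derivative v s) (at s within {a..b})"
    using \<gamma> d(1) unfolding C1_curve_def by fast
  have "continuous_on ?I (snd d \<circ> \<gamma>)"
    unfolding continuous_on_eq_continuous_within
    by (rule ballI, rule continuous_within_subset[OF has_vector_derivative_continuous[OF v']]) auto
  then have "continuous_on ?I (\<lambda>s. g d (chart_inv d ((snd d \<circ> \<gamma>) s)))"
    by (rule continuous_on_compose2[OF gram_continuous_on[OF d(1)]]) auto
  then have gc: "continuous_on ?I (\<lambda>s. g d (\<gamma> s))"
    by (rule continuous_on_eq) (use d in auto)
  have "continuous_on ?I (\<lambda>s. sqrt (v s \<bullet> (g d (\<gamma> s) *v v s)))"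
    using v gc unfolding matrix_vector_mult_def by (intro continuous_intros) auto
  then have "continuous_on ?I (piece_speed a b \<gamma>)"
  proof (rule continuous_on_eq)
    fix s assume s: "s \<in> ?I"
    then show "sqrt (v s \<bullet> (g d (\<gamma> s) *v v s)) = piece_speed a b \<gamma> s"
      using piece_speed_in_chart[OF \<gamma> ab _ d(1) _ v'[OF s]] by simp
  qed
  then have within: "continuous (at t within ?I) (piece_speed a b \<gamma>)"
    using t d by (simp add: continuous_on_eq_continuous_within)
  obtain \<delta> where \<delta>: "0 < \<delta>" "\<forall>s\<in>{a..b}. dist s t < \<delta> \<longrightarrow> \<gamma> s \<in> fst d"
    using curve_stays_in_open[OF cont chart_domain_openin[OF d(1)] t d(2)] by meson
  have "at t within ?I = at t within {a..b}"
    by (rule at_within_nhd[of t "ball t \<delta>"]) (use \<delta> in \<open>auto simp: dist_commute\<close>)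
  with within show "continuous (at t within {a..b}) (piece_speed a b \<gamma>)" by simp
qed

lemma speed_eq_piece_speed:
  assumes "{a..b} \<subseteq> {0..1}" "t \<in> {a<..<b}"
  shows "speed A g \<gamma> t = piece_speed a b \<gamma> t"
proof -
  have t: "t \<in> interior {a..b}" "t \<in> interior {0..1}"
    using assms interior_mono[OF assms(1)] by auto
  have "at t within {0..1} = at t within {a..b}"
    unfolding at_within_interior[OF t(1)] at_within_interior[OF t(2)] ..
  then show ?thesis unfolding speed_def piece_speed_def by simp
qed

lemma C1_curve_speed_integrable:
  assumes "C1_curve T A a b \<gamma>" "a < b" "{a..b} \<subseteq> {0..1}"
  shows "speed A g \<gamma> integrable_on {a..b}"
proof (rule integrable_spike_finite[of "{a, b}" _ _ "piece_speed a b \<gamma>"])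
  show "piece_speed a b \<gamma> integrable_on {a..b}"
    using piece_speed_continuous[OF assms(1,2)] by (rule integrable_continuous_interval)
qed (use speed_eq_piece_speed[OF assms(3)] in auto)

lemma C1_curve_speed_interior:
  assumes \<gamma>: "C1_curve T A a b \<gamma>" and ab: "a < b" "{a..b} \<subseteq> {0..1}" and t: "t \<in> {a<..<b}"
    and d: "d \<in> A" "\<gamma> t \<in> fst d"
  shows "\<exists>w. ((snd d \<circ> \<gamma>) has_vector_derivative w) (at t) \<and>
    speed A g \<gamma> t = sqrt (w \<bullet> (g d (\<gamma> t) *v w))"
proof -
  have t': "t \<in> {a..b}" using t by auto
  obtain w where w: "((snd d \<circ> \<gamma>) has_vector_derivative w) (at t within {a..b})"
    using \<gamma> d t' unfolding C1_curve_def by blast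
  have "at t within {a..b} = at t" using t by (intro at_within_interior) auto
  with w speed_eq_piece_speed[OF ab(2) t] piece_speed_in_chart[OF \<gamma> ab(1) t' d w]
  show ?thesis by auto
qed

lemma speed_nonneg:
  assumes "\<gamma> t \<in> topspace T"
  shows "0 \<le> speed A g \<gamma> t"
proof -
  define c where "c = (SOME c. c \<in> A \<and> \<gamma> t \<in> fst c)"
  have "c \<in> A \<and> \<gamma> t \<in> fst c"
    unfolding c_def using chart_around[OF assms] by (metis (mono_tags, lifting) someI)
  then show ?thesis
    unfolding speed_def c_def[symmetric] Let_def using gram_nonneg by simp
qed

text \<open>The three properties through which piecewise curves are used. Integrability matters because the
  integral of a nonintegrable function is zero by convention, so that without it a curve could
  have length zero.\<close>

lemma piecewise_C1_curve_regular:
  assumes "piecewise_C1_curve T A \<gamma>"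
  shows "continuous_map (top_of_set {0..1}) T \<gamma>"
    and "speed A g \<gamma> integrable_on {0..1}"
    and "\<exists>S. finite S \<and> (\<forall>t\<in>{0..1} - S. \<forall>d\<in>A. \<gamma> t \<in> fst d \<longrightarrow>
      (\<exists>w. ((snd d \<circ> \<gamma>) has_vector_derivative w) (at t) \<and>
        speed A g \<gamma> t = sqrt (w \<bullet> (g d (\<gamma> t) *v w))))"
proof -
  obtain s :: "nat \<Rightarrow> real" and n where s01: "s 0 = 0" "s n = 1"
    and less: "\<And>i. i < n \<Longrightarrow> s i < s (Suc i)"
    and C1: "\<And>i. i < n \<Longrightarrow> C1_curve T A (s i) (s (Suc i)) \<gamma>"
    using assms unfolding piecewise_C1_curve_def by blast
  have n: "0 < n" using s01 by (cases n) auto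
  have mono: "s i \<le> s j" if "i \<le> j" "j \<le> n" for i j
    using partition_mono[of n s i j] less that by blast
  have piece: "{s i..s (Suc i)} \<subseteq> {0..1}" if "i < n" for i
    using mono[of 0 i] mono[of "Suc i" n] that s01 by auto
  have cover: "\<exists>i<n. t \<in> {s i..s (Suc i)}" if "t \<in> {0..1}" for t
    using partition_covers[of t s n] that n s01 by auto
  have cont: "continuous_map (top_of_set {s i..s (Suc i)}) T \<gamma>" if "i < n" for i
    using C1[OF that] unfolding C1_curve_def by blast
  show "continuous_map (top_of_set {0..1}) T \<gamma>"
    unfolding continuous_map_closedin
  proof (intro conjI allI impI)
    show "\<gamma> \<in> topspace (top_of_set {0..1}) \<rightarrow> topspace T"
    proof
      fix t assume "t \<in> topspace (top_of_set {0..1::real})"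
      then obtain i where "i < n" "t \<in> {s i..s (Suc i)}" using cover by auto
      then show "\<gamma> t \<in> topspace T"
        using cont[of i] by (auto simp: continuous_map_def)
    qed
    fix C assume C: "closedin T C"
    have "closed {t \<in> {s i..s (Suc i)}. \<gamma> t \<in> C}" if "i < n" for i
      using closedin_continuous_map_preimage[OF cont[OF that] C]
      by (auto intro: closedin_closed_trans)
    then have "closed (\<Union>i<n. {t \<in> {s i..s (Suc i)}. \<gamma> t \<in> C})"
      by (intro closed_UN) auto
    moreover have "(\<Union>i<n. {t \<in> {s i..s (Suc i)}. \<gamma> t \<in> C}) = {t \<in> {0..1}. \<gamma> t \<in> C}"
      using piece cover by blast
    ultimately have "closed {t \<in> {0..1}. \<gamma> t \<in> C}" by metis
    then show "closedin (top_of_set {0..1}) {t \<in> topspace (top_of_set {0..1}). \<gamma> t \<in> C}"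
      by (auto intro: closed_subset)
  qed
  have "speed A g \<gamma> integrable_on {s 0..s k}" if "k \<le> n" for k
    using that
  proof (induction k)
    case (Suc k)
    then have k: "k < n" "speed A g \<gamma> integrable_on {s 0..s k}" by auto
    show ?case
    proof (rule Henstock_Kurzweil_Integration.integrable_combine[OF _ _ k(2)])
      show "speed A g \<gamma> integrable_on {s k..s (Suc k)}"
        by (rule C1_curve_speed_integrable[OF C1[OF k(1)] less[OF k(1)] piece[OF k(1)]])
    qed (use mono[of 0 k] less[OF k(1)] k(1) in simp_all)
  next
    case 0
    show ?case using integrable_on_refl[of "speed A g \<gamma>" "s 0"] by simp
  qed
  from this[of n] show "speed A g \<gamma> integrable_on {0..1}" using s01 by simp
  show "\<exists>S. finite S \<and> (\<forall>t\<in>{0..1} - S. \<forall>d\<in>A. \<gamma> t \<in> fst d \<longrightarrow>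
      (\<exists>w. ((snd d \<circ> \<gamma>) has_vector_derivative w) (at t) \<and>
        speed A g \<gamma> t = sqrt (w \<bullet> (g d (\<gamma> t) *v w))))"
  proof (intro exI[of _ "s ` {..n}"] conjI ballI impI)
    fix t d assume t: "t \<in> {0..1} - s ` {..n}" and d: "d \<in> A" "\<gamma> t \<in> fst d"
    obtain i where i: "i < n" "t \<in> {s i..s (Suc i)}" using cover t by blast
    moreover have "t \<noteq> s i" "t \<noteq> s (Suc i)" using t i(1) by auto
    ultimately have "t \<in> {s i<..<s (Suc i)}" by auto
    then show "\<exists>w. ((snd d \<circ> \<gamma>) has_vector_derivative w) (at t) \<and>
        speed A g \<gamma> t = sqrt (w \<bullet> (g d (\<gamma> t) *v w))"
      using C1_curve_speed_interior[OF C1[OF i(1)] less[OF i(1)] piece[OF i(1)] _ d] by blast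
  qed auto
qed

section \<open>Distinct points have positive distance\<close>

text \<open>Until its first exit time the curve runs in a closed coordinate ball, where its speed is at least
  \<open>m\<close> times its Euclidean speed; by the fundamental theorem of calculus the latter integrates to at
  least the Euclidean distance \<open>\<epsilon>\<close> covered.\<close>

lemma curve_length_ge_if_leaves_ball:
  assumes \<gamma>: "piecewise_C1_curve T A \<gamma>" and c: "c \<in> A" and start: "\<gamma> 0 \<in> fst c"
    and m: "0 < m" and \<epsilon>: "0 < \<epsilon>"
    and K: "compact (cball (snd c (\<gamma> 0)) \<epsilon> \<inter> snd c ` fst c)"
    and bound: "\<And>q v. q \<in> fst c \<Longrightarrow> snd c q \<in> cball (snd c (\<gamma> 0)) \<epsilon> \<Longrightarrow>
      m * norm v \<le> sqrt (v \<bullet> (g c q *v v))"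
    and leaves: "\<gamma> 1 \<notin> {x \<in> fst c. snd c x \<in> ball (snd c (\<gamma> 0)) \<epsilon>}"
  shows "m * \<epsilon> \<le> curve_length A g \<gamma>"
proof -
  let ?p = "snd c (\<gamma> 0)"
  define U where "U = {x \<in> fst c. snd c x \<in> ball ?p \<epsilon>}"
  define D where "D = {x \<in> fst c. snd c x \<in> cball ?p \<epsilon>}"
  have UD: "U \<subseteq> D" unfolding U_def D_def by auto
  have Dc: "D \<subseteq> fst c" unfolding D_def by auto
  have U: "openin T U" unfolding U_def by (rule openin_chart_vimage[OF c open_ball])
  have "D = chart_inv c ` (cball ?p \<epsilon> \<inter> snd c ` fst c)"
    unfolding D_def using chart_inv_chart[OF c] by force
  moreover have "compactin (top_of_set (snd c ` fst c)) (cball ?p \<epsilon> \<inter> snd c ` fst c)"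
    using K by (simp add: compactin_subtopology)
  ultimately have "compactin T D"
    using image_compactin continuous_map_chart_inv[OF c] by metis
  then have D: "closedin T D" using compactin_imp_closedin Hausdorff by blast
  have cont: "continuous_map (top_of_set {0..1}) T \<gamma>"
    by (rule piecewise_C1_curve_regular(1)[OF \<gamma>])
  have closed: "closed {t \<in> {0..1}. \<gamma> t \<in> X}" if "closedin T X" for X
    using closedin_continuous_map_preimage[OF cont that] by (auto intro: closedin_closed_trans)
  have top: "\<gamma> t \<in> topspace T" if "t \<in> {0..1}" for t
    using cont that by (auto simp: continuous_map_def)

  \<comment> \<open>the exit time \<open>\<tau>\<close> is the least time outside the open ball \<open>U\<close>; the compactness, hence closedness,
    of \<open>D\<close> keeps the curve in the chart domain at time \<open>\<tau>\<close> itself\<close>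
  define Z where "Z = {t \<in> {0..1}. \<gamma> t \<in> topspace T - U}"
  have Z: "closed Z" unfolding Z_def using closed[of "topspace T - U"] U by blast
  have "1 \<in> Z" using leaves top[of 1] unfolding Z_def U_def by auto
  have bdd: "bdd_below Z" unfolding Z_def by (auto intro!: bdd_belowI[of _ 0])
  define \<tau> where "\<tau> = Inf Z"
  have \<tau>Z: "\<tau> \<in> Z" unfolding \<tau>_def using closed_contains_Inf bdd Z \<open>1 \<in> Z\<close> by blast
  have \<tau>1: "\<tau> \<le> 1" and \<tau>0: "0 \<le> \<tau>" using \<tau>Z unfolding Z_def by auto
  have "\<gamma> 0 \<in> U" unfolding U_def using start \<epsilon> by auto
  then have \<tau>pos: "0 < \<tau>" using \<tau>Z \<tau>0 unfolding Z_def by (cases "\<tau> = 0") auto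
  have before: "\<gamma> t \<in> U" if "t \<in> {0..<\<tau>}" for t
  proof (rule ccontr)
    assume "\<gamma> t \<notin> U"
    then have "t \<in> Z" using that \<tau>1 top[of t] unfolding Z_def by auto
    then have "\<tau> \<le> t" unfolding \<tau>_def using bdd by (rule cInf_lower)
    then show False using that by auto
  qed
  have "closure {0..<\<tau>} \<subseteq> {t \<in> {0..1}. \<gamma> t \<in> D}"
    using before UD \<tau>1 by (intro closure_minimal closed[OF D]) auto
  then have inD: "\<gamma> t \<in> D" if "t \<in> {0..\<tau>}" for t
    using that \<tau>pos by auto
  have "\<gamma> \<tau> \<notin> U" using \<tau>Z unfolding Z_def by auto
  then have far: "\<epsilon> \<le> dist ?p (snd c (\<gamma> \<tau>))"
    using inD[of \<tau>] \<tau>0 unfolding U_def D_def by auto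

  have sub: "{0..\<tau>} \<subseteq> {0..1}" using \<tau>1 by auto
  have "continuous_map (top_of_set {0..\<tau>}) T \<gamma>"
    using continuous_map_from_subtopology_mono[OF cont sub] .
  then have "continuous_map (top_of_set {0..\<tau>}) (subtopology T (fst c)) \<gamma>"
    using inD Dc by (intro continuous_map_into_subtopology) auto
  from continuous_map_compose[OF this continuous_map_chart[OF c]]
  have cont\<tau>: "continuous_on {0..\<tau>} (snd c \<circ> \<gamma>)" by simp
  obtain S where S: "finite S" "\<And>t. t \<in> {0..1} - S \<Longrightarrow> \<gamma> t \<in> fst c \<Longrightarrow>
      \<exists>w. ((snd c \<circ> \<gamma>) has_vector_derivative w) (at t) \<and>
        speed A g \<gamma> t = sqrt (w \<bullet> (g c (\<gamma> t) *v w))"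
    using piecewise_C1_curve_regular(3)[OF \<gamma>] c by meson
  \<comment> \<open>at the break points in \<open>S\<close> the velocity may be undefined, and the value \<open>0\<close> keeps it below the speed\<close>
  define v where "v t = (if t \<in> S then 0 else vector_derivative (snd c \<circ> \<gamma>) (at t))" for t
  have v: "((snd c \<circ> \<gamma>) has_vector_derivative v t) (at t) \<and>
        speed A g \<gamma> t = sqrt (v t \<bullet> (g c (\<gamma> t) *v v t))" if "t \<in> {0..\<tau>} - S" for t
  proof -
    have "t \<in> {0..1} - S" "\<gamma> t \<in> fst c" using that sub inD Dc by auto
    from S(2)[OF this] obtain w where "((snd c \<circ> \<gamma>) has_vector_derivative w) (at t)"
        "speed A g \<gamma> t = sqrt (w \<bullet> (g c (\<gamma> t) *v w))" by blast
    moreover from this have "v t = w"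
      using that unfolding v_def by (simp add: vector_derivative_at)
    ultimately show ?thesis by simp
  qed
  have v_int: "(v has_integral ((snd c \<circ> \<gamma>) \<tau> - (snd c \<circ> \<gamma>) 0)) {0..\<tau>}"
    by (rule fundamental_theorem_of_calculus_interior_strong[OF S(1) \<tau>0 _ cont\<tau>])
      (use v in auto)
  have int01: "speed A g \<gamma> integrable_on {0..1}"
    by (rule piecewise_C1_curve_regular(2)[OF \<gamma>])
  then have int\<tau>: "speed A g \<gamma> integrable_on {0..\<tau>}"
    by (rule integrable_on_subinterval) (use sub in auto)
  have "m * \<epsilon> \<le> m * norm ((snd c \<circ> \<gamma>) \<tau> - (snd c \<circ> \<gamma>) 0)"
    using far m by (simp add: dist_norm norm_minus_commute)
  also have "\<dots> = norm (integral {0..\<tau>} (\<lambda>t. m *\<^sub>R v t))"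
    using v_int m by (simp add: integral_unique)
  also have "\<dots> \<le> integral {0..\<tau>} (speed A g \<gamma>)"
  proof (rule Henstock_Kurzweil_Integration.integral_norm_bound_integral[OF _ int\<tau>])
    show "(\<lambda>t. m *\<^sub>R v t) integrable_on {0..\<tau>}"
      using v_int by (intro integrable_cmul) blast
    fix t assume t: "t \<in> {0..\<tau>}"
    show "norm (m *\<^sub>R v t) \<le> speed A g \<gamma> t"
    proof (cases "t \<in> S")
      case True
      then show ?thesis using speed_nonneg top[of t] t sub by (auto simp: v_def)
    next
      case False
      have "m * norm (v t) \<le> sqrt (v t \<bullet> (g c (\<gamma> t) *v v t))"
        using inD[OF t] bound unfolding D_def by blast
      then show ?thesis using v[of t] False t m by simp
    qed
  qed
  also have "\<dots> \<le> integral {0..1} (speed A g \<gamma>)"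
    using speed_nonneg top by (intro integral_subset_le[OF sub int\<tau> int01]) auto
  finally show ?thesis unfolding curve_length_def .
qed

lemma curve_length_nonneg:
  assumes "piecewise_C1_curve T A \<gamma>"
  shows "0 \<le> curve_length A g \<gamma>"
proof -
  have "\<gamma> t \<in> topspace T" if "t \<in> {0..1}" for t
    using piecewise_C1_curve_regular(1)[OF assms] that by (auto simp: continuous_map_def)
  then show ?thesis
    unfolding curve_length_def using speed_nonneg
    by (intro integral_nonneg piecewise_C1_curve_regular(2)[OF assms]) auto
qed

text \<open>The radius is chosen below the coordinate distance to \<open>q\<close> if \<open>q\<close> lies in the chart, so that every
  curve to \<open>q\<close> has to leave the coordinate ball.\<close>

lemma curve_length_bounded_away:
  assumes p: "p \<in> topspace T" and pq: "p \<noteq> q"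
  shows "\<exists>\<delta>>0. \<forall>\<gamma>. piecewise_C1_curve T A \<gamma> \<and> \<gamma> 0 = p \<and> \<gamma> 1 = q \<longrightarrow> \<delta> \<le> curve_length A g \<gamma>"
proof -
  obtain c where c: "c \<in> A" "p \<in> fst c" using chart_around[OF p] by blast
  define e where "e = (if q \<in> fst c then dist (snd c p) (snd c q) else 1)"
  have "0 < e"
    using chart_inj_on[OF c(1)] c(2) pq unfolding e_def by (auto dest: inj_onD)
  then obtain \<epsilon> where \<epsilon>: "0 < \<epsilon>" "\<epsilon> < e"
    and K: "compact (cball (snd c p) \<epsilon> \<inter> snd c ` fst c)"
    using chart_small_ball[OF c] by blast
  obtain m where m: "0 < m" and bound: "\<And>x v. x \<in> fst c \<Longrightarrow>
      snd c x \<in> cball (snd c p) \<epsilon> \<inter> snd c ` fst c \<Longrightarrow> m * norm v \<le> sqrt (v \<bullet> (g c x *v v))"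
    using gram_lower_bound[OF c(1) K] by blast
  have "q \<notin> {x \<in> fst c. snd c x \<in> ball (snd c p) \<epsilon>}"
    using \<epsilon>(2) unfolding e_def by auto
  then have "m * \<epsilon> \<le> curve_length A g \<gamma>"
    if "piecewise_C1_curve T A \<gamma>" "\<gamma> 0 = p" "\<gamma> 1 = q" for \<gamma>
    using curve_length_ge_if_leaves_ball[OF that(1) c(1) _ m \<epsilon>(1)] that c(2) K bound by blast
  then show ?thesis using m \<epsilon>(1) by (intro exI[of _ "m * \<epsilon>"]) auto
qed

section \<open>Joining points by piecewise C1 curves\<close>

lemma C1_curve_cong:
  assumes \<gamma>: "C1_curve T A a b \<gamma>" and eq: "\<And>t. t \<in> {a..b} \<Longrightarrow> \<gamma>' t = \<gamma> t"
  shows "C1_curve T A a b \<gamma>'"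
  unfolding C1_curve_def
proof (intro conjI ballI)
  have "continuous_map (top_of_set {a..b}) T \<gamma>" using \<gamma> unfolding C1_curve_def by blast
  then show "continuous_map (top_of_set {a..b}) T \<gamma>'"
    by (rule continuous_map_eq) (use eq in auto)
  fix c assume "c \<in> A"
  then obtain v where v: "continuous_on {t \<in> {a..b}. \<gamma> t \<in> fst c} v"
    and v': "\<forall>t\<in>{a..b}. \<gamma> t \<in> fst c \<longrightarrow> ((snd c \<circ> \<gamma>) has_vector_derivative v t) (at t within {a..b})"
    using \<gamma> unfolding C1_curve_def by blast
  have same: "{t \<in> {a..b}. \<gamma>' t \<in> fst c} = {t \<in> {a..b}. \<gamma> t \<in> fst c}" using eq by auto
  have "((snd c \<circ> \<gamma>') has_vector_derivative v t) (at t within {a..b})"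
    if "t \<in> {a..b}" "\<gamma>' t \<in> fst c" for t
    by (rule has_vector_derivative_transform[OF that(1) _ v'[rule_format, of t]])
      (use that eq in auto)
  then show "\<exists>v. continuous_on {t \<in> {a..b}. \<gamma>' t \<in> fst c} v \<and>
      (\<forall>t\<in>{a..b}. \<gamma>' t \<in> fst c \<longrightarrow>
        ((snd c \<circ> \<gamma>') has_vector_derivative v t) (at t within {a..b}))"
    unfolding same using v by blast
qed

lemma C1_curve_affine:
  fixes a b a' b' m k :: real
  assumes \<gamma>: "C1_curve T A a b \<gamma>" and m: "0 < m" and a: "m * a' + k = a" and b: "m * b' + k = b"
  shows "C1_curve T A a' b' (\<lambda>t. \<gamma> (m * t + k))"
  unfolding C1_curve_def
proof (intro conjI ballI)
  let ?l = "\<lambda>t::real. m * t + k"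
  have l: "?l t \<in> {a..b}" if "t \<in> {a'..b'}" for t
    using that m a b by auto
  have cont: "continuous_map (top_of_set {a..b}) T \<gamma>" using \<gamma> unfolding C1_curve_def by blast
  have "continuous_map (top_of_set {a'..b'}) (top_of_set {a..b}) ?l"
    using l by (auto intro!: continuous_intros)
  from continuous_map_compose[OF this cont]
  show "continuous_map (top_of_set {a'..b'}) T (\<lambda>t. \<gamma> (m * t + k))"
    unfolding o_def .
  fix c assume "c \<in> A"
  then obtain v where v: "continuous_on {t \<in> {a..b}. \<gamma> t \<in> fst c} v"
    and v': "\<forall>t\<in>{a..b}. \<gamma> t \<in> fst c \<longrightarrow> ((snd c \<circ> \<gamma>) has_vector_derivative v t) (at t within {a..b})"
    using \<gamma> unfolding C1_curve_def by blast
  show "\<exists>v. continuous_on {t \<in> {a'..b'}. \<gamma> (m * t + k) \<in> fst c} v \<and>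
      (\<forall>t\<in>{a'..b'}. \<gamma> (m * t + k) \<in> fst c \<longrightarrow>
        ((snd c \<circ> (\<lambda>t. \<gamma> (m * t + k))) has_vector_derivative v t) (at t within {a'..b'}))"
  proof (intro exI[of _ "\<lambda>t. m *\<^sub>R v (?l t)"] conjI ballI impI)
    have "continuous_on {t \<in> {a'..b'}. \<gamma> (m * t + k) \<in> fst c} (\<lambda>t. v (?l t))"
      by (rule continuous_on_compose2[OF v]) (use l in \<open>auto intro!: continuous_intros\<close>)
    then show "continuous_on {t \<in> {a'..b'}. \<gamma> (m * t + k) \<in> fst c} (\<lambda>t. m *\<^sub>R v (?l t))"
      by (intro continuous_intros)
    fix t assume t: "t \<in> {a'..b'}" "\<gamma> (m * t + k) \<in> fst c"
    have "((snd c \<circ> \<gamma>) has_vector_derivative v (?l t)) (at (?l t) within {a..b})"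
      using v' l[OF t(1)] t(2) by blast
    then have 1: "((snd c \<circ> \<gamma>) has_vector_derivative v (?l t)) (at (?l t) within ?l ` {a'..b'})"
      by (rule has_vector_derivative_within_subset) (use l in blast)
    have 2: "(?l has_vector_derivative m) (at t within {a'..b'})"
      by (auto intro!: derivative_eq_intros simp: has_real_derivative_iff_has_vector_derivative[symmetric])
    show "((snd c \<circ> (\<lambda>t. \<gamma> (m * t + k))) has_vector_derivative m *\<^sub>R v (?l t)) (at t within {a'..b'})"
      using vector_diff_chain_within[OF 2 1] by (simp add: o_def)
  qed
qed

text \<open>In the chart \<open>c\<close> the velocity is the constant \<open>y - x\<close>. The point is that the curve is \<open>C1\<close> in every
  other chart \<open>d\<close> as well: there its velocity is locally the derivative of an extension of
  the transition map, in the fixed direction \<open>y - x\<close>, at a moving point.\<close>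

lemma chart_segment_C1_curve:
  assumes c: "c \<in> A" and seg: "closed_segment x y \<subseteq> snd c ` fst c"
  shows "C1_curve T A 0 1 (\<lambda>t. chart_inv c (x + t *\<^sub>R (y - x)))"
proof -
  define l where "l t = x + t *\<^sub>R (y - x)" for t :: real
  define \<gamma> where "\<gamma> t = chart_inv c (l t)" for t
  have l: "l t \<in> snd c ` fst c" if "t \<in> {0..1}" for t
  proof -
    have "l t = (1 - t) *\<^sub>R x + t *\<^sub>R y" unfolding l_def by (simp add: algebra_simps)
    then have "l t \<in> closed_segment x y" using that unfolding closed_segment_def by auto
    then show ?thesis using seg by blast
  qed
  have \<gamma>c: "\<gamma> t \<in> fst c" and cl: "(snd c \<circ> \<gamma>) t = l t" if "t \<in> {0..1}" for t
    using l[OF that] c unfolding \<gamma>_def by auto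
  have "continuous_map (top_of_set {0..1}) (top_of_set (snd c ` fst c)) l"
    using l unfolding l_def by (auto intro!: continuous_intros)
  from continuous_map_compose[OF this continuous_map_chart_inv[OF c]]
  have cont: "continuous_map (top_of_set {0..1}) T \<gamma>"
    unfolding \<gamma>_def o_def .
  have l_vel: "(l has_vector_derivative (y - x)) (at t within S)" for t S
    unfolding l_def by (auto intro!: derivative_eq_intros)
  have vel: "((snd c \<circ> \<gamma>) has_vector_derivative (y - x)) (at t within {0..1})" if "t \<in> {0..1}" for t
    by (rule has_vector_derivative_transform[OF that _ l_vel]) (use cl in auto)
  have l_cont: "isCont l t" for t unfolding l_def by (intro continuous_intros)
  have "\<exists>v. continuous_on {t \<in> {0..1}. \<gamma> t \<in> fst d} v \<and>
      (\<forall>t\<in>{0..1}. \<gamma> t \<in> fst d \<longrightarrow> ((snd d \<circ> \<gamma>) has_vector_derivative v t) (at t within {0..1}))"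
    if d: "d \<in> A" for d
  proof (intro exI[of _ "\<lambda>t. vector_derivative (snd d \<circ> \<gamma>) (at t within {0..1})"] conjI ballI impI)
    fix t :: real assume t: "t \<in> {0..1}" and td: "\<gamma> t \<in> fst d"
    obtain J where "((snd d \<circ> \<gamma>) has_vector_derivative J) (at t within {0..1})"
      using transition_velocity[OF c d t _ cont vel[OF t]] \<gamma>c[OF t] td by blast
    then show "((snd d \<circ> \<gamma>) has_vector_derivative vector_derivative (snd d \<circ> \<gamma>) (at t within {0..1}))
        (at t within {0..1})"
      using vector_derivative_works differentiableI_vector by blast
  next
    let ?I = "{t \<in> {0..1}. \<gamma> t \<in> fst d}"
    show "continuous_on ?I (\<lambda>t. vector_derivative (snd d \<circ> \<gamma>) (at t within {0..1}))"
      unfolding continuous_on_eq_continuous_within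
    proof
      fix t assume t: "t \<in> ?I"
      then have t01: "t \<in> {0..1}" and tcd: "\<gamma> t \<in> fst c \<inter> fst d" using \<gamma>c by auto
      obtain W F where W: "open W" "snd c (\<gamma> t) \<in> W" and F: "F differentiable_on W"
        and F': "\<And>v. continuous_on W (\<lambda>x. frechet_derivative F (at x) v)"
        and Fd: "\<And>q. q \<in> fst c \<inter> fst d \<Longrightarrow> snd c q \<in> W \<Longrightarrow> F (snd c q) = snd d q"
        using transition_extension[OF c d tcd] by metis
      let ?f = "\<lambda>s. frechet_derivative F (at (l s)) (y - x)"
      have "l t \<in> W" using W(2) cl[OF t01] by simp
      then have "isCont (\<lambda>x. frechet_derivative F (at x) (y - x')) (l t)" for x'
        using F' W(1) continuous_on_eq_continuous_at by blast
      then have "isCont ?f t"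
        using isCont_o2[OF l_cont] by blast
      then have fc: "continuous (at t within ?I) ?f"
        by (rule continuous_at_imp_continuous_at_within)
      obtain \<delta> where \<delta>: "0 < \<delta>"
        "\<forall>s\<in>{0..1}. dist s t < \<delta> \<longrightarrow> \<gamma> s \<in> {q \<in> fst c. snd c q \<in> W}"
        using curve_stays_in_open[OF cont openin_chart_vimage[OF c W(1)] t01] tcd W(2) by blast
      show "continuous (at t within ?I) (\<lambda>t. vector_derivative (snd d \<circ> \<gamma>) (at t within {0..1}))"
      proof (rule continuous_transform_within[OF fc \<delta>(1) t])
        fix s assume s: "s \<in> ?I" "dist s t < \<delta>"
        then have s01: "s \<in> {0..1}" and scd: "\<gamma> s \<in> fst c \<inter> fst d" and sW: "snd c (\<gamma> s) \<in> W"
          using \<delta>(2) by auto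
        have "((snd d \<circ> \<gamma>) has_vector_derivative frechet_derivative F (at (snd c (\<gamma> s))) (y - x))
            (at s within {0..1})"
          by (rule extension_velocity[OF c d s01 scd cont vel[OF s01] W(1) sW F Fd])
        moreover have "snd c (\<gamma> s) = l s" using cl[OF s01] by simp
        ultimately show "?f s = vector_derivative (snd d \<circ> \<gamma>) (at s within {0..1})"
          using vector_derivative_within_closed_interval[OF zero_less_one s01] by metis
      qed
    qed
  qed
  then have "C1_curve T A 0 1 \<gamma>" unfolding C1_curve_def using cont by blast
  then show ?thesis unfolding \<gamma>_def l_def .
qed

definition joined :: "'a \<Rightarrow> 'a \<Rightarrow> bool" where
  "joined p q \<longleftrightarrow> (\<exists>\<gamma>. piecewise_C1_curve T A \<gamma> \<and> \<gamma> 0 = p \<and> \<gamma> 1 = q)"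

lemma C1_curve_imp_joined: "C1_curve T A 0 1 \<gamma> \<Longrightarrow> joined (\<gamma> 0) (\<gamma> 1)"
  unfolding joined_def piecewise_C1_curve_def
  by (intro exI[of _ \<gamma>] conjI exI[of _ real] exI[of _ 1]) auto

lemma joined_trans:
  assumes "joined p q" "joined q r"
  shows "joined p r"
proof -
  obtain \<gamma> where \<gamma>: "piecewise_C1_curve T A \<gamma>" "\<gamma> 0 = p" "\<gamma> 1 = q"
    using assms(1) unfolding joined_def by blast
  obtain \<eta> where \<eta>: "piecewise_C1_curve T A \<eta>" "\<eta> 0 = q" "\<eta> 1 = r"
    using assms(2) unfolding joined_def by blast
  obtain s :: "nat \<Rightarrow> real" and n where s: "s 0 = 0" "s n = 1"
    "\<forall>i<n. s i < s (Suc i) \<and> C1_curve T A (s i) (s (Suc i)) \<gamma>"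
    using \<gamma>(1) unfolding piecewise_C1_curve_def by blast
  obtain u :: "nat \<Rightarrow> real" and k where u: "u 0 = 0" "u k = 1"
    "\<forall>i<k. u i < u (Suc i) \<and> C1_curve T A (u i) (u (Suc i)) \<eta>"
    using \<eta>(1) unfolding piecewise_C1_curve_def by blast
  \<comment> \<open>the two curves run at double speed, the first on the first half of the unit interval\<close>
  define w where "w i = (if i \<le> n then s i / 2 else (1 + u (i - n)) / 2)" for i
  define \<zeta> where "\<zeta> t = (if t \<le> 1 / 2 then \<gamma> (2 * t + 0) else \<eta> (2 * t + -1))" for t :: real
  have w_late: "w i = (1 + u (i - n)) / 2" if "n \<le> i" for i
    using that s(2) u(1) unfolding w_def by auto
  have "w i < w (Suc i) \<and> C1_curve T A (w i) (w (Suc i)) \<zeta>" if i: "i < n + k" for i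
  proof (cases "i < n")
    case True
    then have w: "w i = s i / 2" "w (Suc i) = s (Suc i) / 2" unfolding w_def by auto
    have "s (Suc i) \<le> 1" using partition_mono[of n s "Suc i" n] s True by auto
    moreover have "C1_curve T A (w i) (w (Suc i)) (\<lambda>t. \<gamma> (2 * t + 0))"
      using s(3) True w by (intro C1_curve_affine[of "s i" "s (Suc i)"]) auto
    ultimately have "C1_curve T A (w i) (w (Suc i)) \<zeta>"
      by (elim C1_curve_cong) (auto simp: \<zeta>_def w)
    moreover have "w i < w (Suc i)" unfolding w using s(3) True by simp
    ultimately show ?thesis by blast
  next
    case False
    then have j: "i - n < k" "Suc i - n = Suc (i - n)" using i by auto
    have w: "w i = (1 + u (i - n)) / 2" "w (Suc i) = (1 + u (Suc (i - n))) / 2"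
      using False w_late[of i] w_late[of "Suc i"] j by auto
    have "0 \<le> u (i - n)" using partition_mono[of k u 0 "i - n"] u j by auto
    moreover have "C1_curve T A (w i) (w (Suc i)) (\<lambda>t. \<eta> (2 * t + -1))"
      using u(3) j w by (intro C1_curve_affine[of "u (i - n)" "u (Suc (i - n))"]) auto
    moreover have "\<zeta> t = \<eta> (2 * t + -1)" if "1 / 2 \<le> t" for t
    proof (cases "t = 1 / 2")
      case True
      then show ?thesis unfolding \<zeta>_def using \<gamma>(3) \<eta>(2) by (simp only: True) simp
    qed (use that in \<open>auto simp: \<zeta>_def\<close>)
    ultimately have "C1_curve T A (w i) (w (Suc i)) \<zeta>"
      by (elim C1_curve_cong) (auto simp: w)
    moreover have "w i < w (Suc i)" unfolding w using u(3) j by simp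
    ultimately show ?thesis by blast
  qed
  moreover have "w 0 = 0" "w (n + k) = 1"
    using s(1) u(2) w_late[of "n + k"] unfolding w_def by auto
  ultimately have "piecewise_C1_curve T A \<zeta>"
    unfolding piecewise_C1_curve_def by blast
  moreover have "\<zeta> 0 = p" "\<zeta> 1 = r" using \<gamma> \<eta> unfolding \<zeta>_def by auto
  ultimately show ?thesis unfolding joined_def by blast
qed

text \<open>Arbitrary pairs in the neighbourhood are joined, not only pairs starting at \<open>p\<close>: a path from \<open>x\<close>
  back to \<open>p\<close> is what shows below that a set of reachable points is closed.\<close>

lemma mutually_joined_neighbourhood:
  assumes p: "p \<in> topspace T"
  obtains U where "openin T U" "p \<in> U" "\<And>x y. x \<in> U \<Longrightarrow> y \<in> U \<Longrightarrow> joined x y"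
proof -
  obtain c where c: "c \<in> A" "p \<in> fst c" using chart_around[OF p] by blast
  obtain \<epsilon> where \<epsilon>: "0 < \<epsilon>" and conv: "convex (cball (snd c p) \<epsilon> \<inter> snd c ` fst c)"
    using chart_small_ball[OF c zero_less_one] by blast
  let ?U = "{q \<in> fst c. snd c q \<in> ball (snd c p) \<epsilon>}"
  show thesis
  proof (rule that)
    show "openin T ?U" using openin_chart_vimage[OF c(1) open_ball] .
    show "p \<in> ?U" using c \<epsilon> by auto
    fix x y assume x: "x \<in> ?U" and y: "y \<in> ?U"
    then have "closed_segment (snd c x) (snd c y) \<subseteq> cball (snd c p) \<epsilon> \<inter> snd c ` fst c"
      by (intro closed_segment_subset conv) auto
    then have "C1_curve T A 0 1 (\<lambda>t. chart_inv c (snd c x + t *\<^sub>R (snd c y - snd c x)))"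
      using chart_segment_C1_curve[OF c(1)] by blast
    from C1_curve_imp_joined[OF this] show "joined x y"
      using x y c(1) by simp
  qed
qed

text \<open>The set of points joined to \<open>p\<close> is open and closed: if a neighbourhood of mutually joined points
  meets it, transitivity puts the whole neighbourhood into it.\<close>

lemma connected_imp_joined:
  assumes conn: "connected_space T" and p: "p \<in> topspace T" and q: "q \<in> topspace T"
  shows "joined p q"
proof -
  let ?R = "{x \<in> topspace T. joined p x}"
  have op: "openin T ?R"
  proof (subst openin_subopen, intro ballI)
    fix x assume x: "x \<in> ?R"
    then obtain U where U: "openin T U" "x \<in> U" "\<And>a b. a \<in> U \<Longrightarrow> b \<in> U \<Longrightarrow> joined a b"
      using mutually_joined_neighbourhood[of x] by blast
    have "U \<subseteq> ?R" using x U joined_trans openin_subset[OF U(1)] by blast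
    then show "\<exists>U. openin T U \<and> x \<in> U \<and> U \<subseteq> ?R" using U by blast
  qed
  have "openin T (topspace T - ?R)"
  proof (subst openin_subopen, intro ballI)
    fix x assume x: "x \<in> topspace T - ?R"
    then obtain U where U: "openin T U" "x \<in> U" "\<And>a b. a \<in> U \<Longrightarrow> b \<in> U \<Longrightarrow> joined a b"
      using mutually_joined_neighbourhood[of x] by blast
    have "U \<subseteq> topspace T - ?R" using x U joined_trans openin_subset[OF U(1)] by blast
    then show "\<exists>U. openin T U \<and> x \<in> U \<and> U \<subseteq> topspace T - ?R" using U by blast
  qed
  then have cl: "closedin T ?R" unfolding closedin_def by auto
  obtain U where U: "p \<in> U" "\<And>a b. a \<in> U \<Longrightarrow> b \<in> U \<Longrightarrow> joined a b"
    using mutually_joined_neighbourhood[OF p] by metis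
  have "joined p p" by (rule U(2)[OF U(1) U(1)])
  then have "p \<in> ?R" using p by simp
  moreover have "?R = {} \<or> ?R = topspace T"
    using conn[unfolded connected_space_clopen_in, rule_format, of ?R] op cl by simp
  ultimately have "q \<in> ?R" using q by (metis empty_iff)
  then show ?thesis by simp
qed

text \<open>Connectedness enters because the infimum of the empty set of reals is an unspecified number.\<close>

lemma riemannian_dist_nonneg:
  assumes "connected_space T" "p \<in> topspace T" "q \<in> topspace T"
  shows "0 \<le> riemannian_dist T A g p q"
  unfolding riemannian_dist_def
proof (rule cInf_greatest)
  show "{curve_length A g \<gamma> |\<gamma>. piecewise_C1_curve T A \<gamma> \<and> \<gamma> 0 = p \<and> \<gamma> 1 = q} \<noteq> {}"
    using connected_imp_joined[OF assms] unfolding joined_def by blast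
qed (use curve_length_nonneg in auto)

lemma riemannian_dist_pos:
  assumes "connected_space T" "p \<in> topspace T" "q \<in> topspace T" "p \<noteq> q"
  shows "0 < riemannian_dist T A g p q"
proof -
  obtain \<delta> where \<delta>: "0 < \<delta>"
    "\<forall>\<gamma>. piecewise_C1_curve T A \<gamma> \<and> \<gamma> 0 = p \<and> \<gamma> 1 = q \<longrightarrow> \<delta> \<le> curve_length A g \<gamma>"
    using curve_length_bounded_away[OF assms(2,4)] by blast
  have "\<delta> \<le> riemannian_dist T A g p q"
    unfolding riemannian_dist_def
  proof (rule cInf_greatest)
    show "{curve_length A g \<gamma> |\<gamma>. piecewise_C1_curve T A \<gamma> \<and> \<gamma> 0 = p \<and> \<gamma> 1 = q} \<noteq> {}"
      using connected_imp_joined[OF assms(1-3)] unfolding joined_def by blast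
  qed (use \<delta>(2) in auto)
  then show ?thesis using \<delta>(1) by simp
qed

section \<open>Geodesic balls are extremal\<close>

lemma riemannian_volume_singleton:
  assumes \<sigma>: "riemannian_volume T A g \<sigma>" and p: "p \<in> topspace T"
  shows "{p} \<in> null_sets \<sigma>"
proof -
  have "snd c ` ({p} \<inter> fst c) \<in> sets lebesgue" for c :: "('a, 'n) chart"
    by (cases "p \<in> fst c") auto
  then have sets: "{p} \<in> sets \<sigma>"
    using \<sigma> p unfolding riemannian_volume_def by auto
  obtain c where c: "c \<in> A" "p \<in> fst c" using chart_around[OF p] by blast
  have "{p} \<subseteq> fst c" using c by auto
  then have "emeasure \<sigma> {p}
      = (\<integral>\<^sup>+x\<in>snd c ` {p}. ennreal (sqrt (det (g c (chart_inv c x)))) \<partial>lebesgue)"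
    using \<sigma> c(1) sets unfolding riemannian_volume_def by blast
  also have "\<dots> = (\<integral>\<^sup>+x. 0 \<partial>(lebesgue :: (real ^ 'n) measure))"
  proof (rule nn_integral_cong_AE)
    have "{snd c p} \<in> null_sets lebesgue" by (intro null_sets_completionI) auto
    then have "AE x in lebesgue. x \<notin> {snd c p}" by (rule AE_not_in)
    then show "AE x in lebesgue. ennreal (sqrt (det (g c (chart_inv c x)))) * indicator (snd c ` {p}) x = 0"
      by eventually_elim auto
  qed
  finally show ?thesis using sets by (simp add: null_sets_def)
qed

end

theorem lemma1p2p6:
  fixes T :: "'a topology"
    and A :: "('a, 'n::finite) chart set"
    and g :: "('a, 'n) gram"
    and \<sigma> :: "'a measure"
    and f :: "real \<Rightarrow> real"
    and x\<^sub>0 :: 'a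
    and C R :: real
  assumes "riemannian_manifold T A g"
    and "compact_space T"
    and "connected_space T"
    and "riemannian_volume T A g \<sigma>"
    and "x\<^sub>0 \<in> topspace T"
    and "\<And>t. 0 < t \<Longrightarrow> 0 \<le> f t"
    and "strict_antimono_on {0<..} f"
    and "0 < C"
    and "emeasure \<sigma> (geodesic_ball T A g x\<^sub>0 R) = ennreal C"
  shows "(SUP \<Omega>\<in>{\<Omega>\<in>sets \<sigma>. emeasure \<sigma> \<Omega> = ennreal C}.
            \<integral>\<^sup>+x\<in>\<Omega>. ennreal (f (riemannian_dist T A g x\<^sub>0 x)) \<partial>\<sigma>)
       = (\<integral>\<^sup>+x\<in>geodesic_ball T A g x\<^sub>0 R. ennreal (f (riemannian_dist T A g x\<^sub>0 x)) \<partial>\<sigma>)"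
proof (rule antisym)
  interpret riemannian T A g using assms(1) by unfold_locales
  let ?r = "riemannian_dist T A g x\<^sub>0"
  let ?B = "geodesic_ball T A g x\<^sub>0 R"
  \<comment> \<open>nonmeasurable sets are assigned measure zero, so the ball is measurable\<close>
  have pos: "emeasure \<sigma> ?B \<noteq> 0" using assms(8,9) by simp
  then have B: "?B \<in> sets \<sigma>" using emeasure_notin_sets by blast
  \<comment> \<open>a point of the ball has nonnegative distance below \<open>R\<close>, so \<open>R\<close> lies in the range where \<open>f\<close> decreases\<close>
  have "?B \<noteq> {}" using pos by auto
  then obtain y where y: "y \<in> topspace T" "?r y < R" unfolding geodesic_ball_def by blast
  then have R: "0 < R" using riemannian_dist_nonneg[OF assms(3,5) y(1)] by simp
  have mono: "f t \<le> f s" if "0 < s" "s \<le> t" for s t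
    using assms(7) that by (cases "s = t") (auto simp: monotone_on_def less_imp_le)
  show "(SUP \<Omega>\<in>{\<Omega>\<in>sets \<sigma>. emeasure \<sigma> \<Omega> = ennreal C}. \<integral>\<^sup>+x\<in>\<Omega>. ennreal (f (?r x)) \<partial>\<sigma>)
      \<le> (\<integral>\<^sup>+x\<in>?B. ennreal (f (?r x)) \<partial>\<sigma>)"
  proof (rule SUP_least, clarify)
    fix \<Omega> assume \<Omega>: "\<Omega> \<in> sets \<sigma>" "emeasure \<sigma> \<Omega> = ennreal C"
    show "(\<integral>\<^sup>+x\<in>\<Omega>. ennreal (f (?r x)) \<partial>\<sigma>) \<le> (\<integral>\<^sup>+x\<in>?B. ennreal (f (?r x)) \<partial>\<sigma>)"
    proof (rule nn_integral_bathtub[OF B \<Omega>(1) _ _ riemannian_volume_singleton[OF assms(4,5)]])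
      show "emeasure \<sigma> \<Omega> = emeasure \<sigma> ?B" "emeasure \<sigma> ?B < \<infinity>"
        using \<Omega>(2) assms(9) by simp_all
      show "ennreal (f R) \<le> ennreal (f (?r x))" if "x \<in> ?B - {x\<^sub>0}" for x
        using that riemannian_dist_pos[OF assms(3,5), of x] mono[of "?r x" R]
        unfolding geodesic_ball_def by (auto intro!: ennreal_leI)
      show "ennreal (f (?r x)) \<le> ennreal (f R)" if "x \<in> space \<sigma> - ?B" for x
        using that mono[OF R, of "?r x"] assms(4)
        unfolding geodesic_ball_def riemannian_volume_def by (auto intro!: ennreal_leI)
    qed
  qed
  show "(\<integral>\<^sup>+x\<in>?B. ennreal (f (?r x)) \<partial>\<sigma>)
      \<le> (SUP \<Omega>\<in>{\<Omega>\<in>sets \<sigma>. emeasure \<sigma> \<Omega> = ennreal C}. \<integral>\<^sup>+x\<in>\<Omega>. ennreal (f (?r x)) \<partial>\<sigma>)"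
    using B assms(9) by (intro SUP_upper) auto
qed

end
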